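(* Let $q$ be a complex number with $|q|<1$. Then \[ \sum_{k=0}^{\infty}\frac{1-q^{3k+2}}{1-q^2}\,\frac{(q^2;q^2)_k\,(q;q)_k^2}{(q^3;q^2)_{k}^3}\,q^{\binom{k+1}{2}} =\frac{(q^4;q^2)_{\infty}\,(q^2;q^2)_{\infty}^3}{(q;q^2)_{\infty}\,(q^3;q^2)_{\infty}^3}. \]
   Context: For complex $x,p$ with $|p|<1$ and integer $n\ge 0$: $(x;p)_\infty=\prod_{i=0}^{\infty}(1-xp^i)$ and $(x;p)_n=\prod_{i=0}^{n-1}(1-xp^i)$ (so $(x;p)_0=1$). *)

theory Defs
  imports "HOL-Analysis.Analysis"
begin

definition qpoch :: "complex \<Rightarrow> complex \<Rightarrow> nat \<Rightarrow> complex" where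
  "qpoch x p n = (\<Prod>i<n. 1 - x * p ^ i)"

text \<open>Meaningful only for \<open>norm p < 1\<close>, where the product converges (see \<open>qpoch_inf_has_prod\<close>).\<close>

definition qpoch_inf :: "complex \<Rightarrow> complex \<Rightarrow> complex" where
  "qpoch_inf x p = (\<Prod>i. 1 - x * p ^ i)"

lemma qpoch_inf_has_prod:
  assumes "norm p < 1"
  shows "(\<lambda>i. 1 - x * p ^ i) has_prod qpoch_inf x p"
proof -
  have "summable (\<lambda>i. norm (- (x * p ^ i)))"
    using assms by (simp add: norm_mult norm_power summable_mult summable_geometric)
  then have "abs_convergent_prod (\<lambda>i. 1 + - (x * p ^ i))"
    by (intro summable_imp_abs_convergent_prod) simp
  then have "convergent_prod (\<lambda>i. 1 - x * p ^ i)"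
    using abs_convergent_prod_imp_convergent_prod by fastforce
  then show ?thesis
    unfolding qpoch_inf_def by (rule convergent_prod_has_prod)
qed

end

theory Submission
  imports Defs
begin

text \<open>
  The series is the case \<open>b = q\<close> of a one-parameter family \<open>S(b)\<close> (\<open>cubic_term\<close>) with denominators
  \<open>(q\<^sup>3;q\<^sup>2)\<^sub>k (b q\<^sup>2;q\<^sup>2)\<^sub>k\<^sup>2\<close>. A WZ-type telescoping certificate gives
  \<open>S(b) = (1 - b q) (1 - b q\<^sup>3) / (1 - b q\<^sup>2)\<^sup>2 S(b q\<^sup>2)\<close>; iterating, \<open>S(b)\<close> is an explicit infinite product
  times \<open>S(0)\<close>. The unknown constant \<open>S(0)\<close> is then read off at \<open>b = 1\<close>, where all terms except
  the first vanish because of the factor \<open>(b;q)\<^sub>k\<close>.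
\<close>

section \<open>q-Pochhammer symbols: recurrences, zeros, limits and uniform bounds\<close>

lemma qpoch_0 [simp]: "qpoch x p 0 = 1"
  by (simp add: qpoch_def)

lemma qpoch_0_left [simp]: "qpoch 0 p n = 1"
  by (simp add: qpoch_def)

lemma qpoch_1_left: "qpoch 1 p n = (if n = 0 then 1 else 0)"
  by (cases n) (simp_all add: qpoch_def prod.lessThan_Suc_shift del: prod.lessThan_Suc)

lemma qpoch_Suc: "qpoch x p (Suc n) = qpoch x p n * (1 - x * p ^ n)"
  by (simp add: qpoch_def)

lemma qpoch_Suc_shift: "qpoch x p (Suc n) = (1 - x) * qpoch (x * p) p n"
  unfolding qpoch_def by (subst prod.lessThan_Suc_shift) (simp add: mult_ac)

lemma qpoch_add: "qpoch x p (m + n) = qpoch x p m * qpoch (x * p ^ m) p n"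
  by (induction n) (simp_all add: qpoch_Suc power_add mult_ac)

lemma qpoch_eq_0_iff: "qpoch x p n = 0 \<longleftrightarrow> (\<exists>i<n. x * p ^ i = 1)"
  by (auto simp: qpoch_def)

lemma qpoch_tendsto_qpoch_inf:
  assumes "norm p < 1"
  shows "qpoch x p \<longlonglongrightarrow> qpoch_inf x p"
  unfolding qpoch_def [abs_def]
  by (rule has_prod_imp_tendsto' [OF qpoch_inf_has_prod [OF assms]])

lemma qpoch_inf_eq_0_iff:
  assumes "norm p < 1"
  shows "qpoch_inf x p = 0 \<longleftrightarrow> (\<exists>i. x * p ^ i = 1)"
  using has_prod_eq_0_iff [OF qpoch_inf_has_prod [OF assms]] by (force simp: image_iff)

lemma tendsto_qpoch [tendsto_intros]:
  "(f \<longlongrightarrow> x) F \<Longrightarrow> ((\<lambda>t. qpoch (f t) p n) \<longlongrightarrow> qpoch x p n) F"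
  unfolding qpoch_def by (intro tendsto_intros)

text \<open>Each factor is at most \<open>exp (K * norm p ^ i)\<close>, and these exponents add up
  to at most a geometric series. The bound depends neither on \<open>n\<close> nor on the position
  of \<open>x\<close> in the disc of radius \<open>K\<close>.\<close>

lemma norm_qpoch_le:
  assumes "norm p < 1" "norm x \<le> K"
  shows "norm (qpoch x p n) \<le> exp (K / (1 - norm p))"
proof -
  have "norm (qpoch x p n) \<le> (\<Prod>i<n. exp (K * norm p ^ i))"
    unfolding qpoch_def prod_norm [symmetric]
  proof (rule prod_mono, safe)
    fix i
    have "norm (1 - x * p ^ i) \<le> 1 + norm x * norm p ^ i"
      using norm_triangle_ineq4 [of 1 "x * p ^ i"] by (simp add: norm_mult norm_power)
    also have "\<dots> \<le> 1 + K * norm p ^ i"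
      using assms by (simp add: mult_right_mono)
    also have "\<dots> \<le> exp (K * norm p ^ i)"
      by (rule exp_ge_add_one_self)
    finally show "norm (1 - x * p ^ i) \<le> exp (K * norm p ^ i)" .
  qed simp
  also have "\<dots> = exp (K * (\<Sum>i<n. norm p ^ i))"
    by (simp add: exp_sum [symmetric] sum_distrib_left)
  also have "(\<Sum>i<n. norm p ^ i) \<le> (\<Sum>i. norm p ^ i)"
    using assms by (intro sum_le_suminf summable_geometric) auto
  then have "exp (K * (\<Sum>i<n. norm p ^ i)) \<le> exp (K / (1 - norm p))"
    using assms order_trans [OF norm_ge_zero assms(2)]
    by (simp add: suminf_geometric mult_left_mono divide_inverse)
  finally show ?thesis .
qed

text \<open>The shifted symbol is the quotient of \<open>qpoch x p (m + n)\<close> by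
  \<open>qpoch x p m\<close>. The reciprocals of the former are bounded because they converge (no
  factor vanishes, so the infinite product is nonzero), and the latter is bounded above. Uniformity
  in \<open>m\<close> serves to control denominators while the parameter b runs through b
  q^(2m).\<close>

lemma qpoch_shift_bounded_below:
  assumes p: "norm p < 1" and nz: "\<And>i. x * p ^ i \<noteq> 1"
  obtains c where "c > 0" "\<And>m n. c \<le> norm (qpoch (x * p ^ m) p n)"
proof -
  have nz': "qpoch x p n \<noteq> 0" for n
    using nz by (simp add: qpoch_eq_0_iff)
  have "(\<lambda>n. inverse (qpoch x p n)) \<longlonglongrightarrow> inverse (qpoch_inf x p)"
    using nz p by (intro tendsto_inverse qpoch_tendsto_qpoch_inf) (auto simp: qpoch_inf_eq_0_iff)
  then obtain K where K: "K > 0" "\<And>n. norm (inverse (qpoch x p n)) \<le> K"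
    by (meson convergentI convergent_imp_Bseq BseqE)
  define E where "E = exp (norm x / (1 - norm p))"
  have E: "E > 0" by (simp add: E_def)
  show ?thesis
  proof (rule that [of "inverse (K * E)"])
    show "inverse (K * E) > 0" using K E by simp
    fix m n
    have "inverse (qpoch (x * p ^ m) p n) = inverse (qpoch x p (m + n)) * qpoch x p m"
      using nz'[of m] nz'[of "m + n"] by (simp add: qpoch_add field_simps)
    then have "norm (inverse (qpoch (x * p ^ m) p n)) \<le> K * E"
      unfolding E_def using K p by (simp only: norm_mult) (intro mult_mono norm_qpoch_le; simp)
    moreover have "qpoch (x * p ^ m) p n \<noteq> 0"
      using nz'[of "m + n"] by (auto simp: qpoch_add)
    ultimately show "inverse (K * E) \<le> norm (qpoch (x * p ^ m) p n)"
      using le_imp_inverse_le [of "norm (inverse (qpoch (x * p ^ m) p n))" "K * E"]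
      by (simp add: norm_inverse)
  qed
qed

section \<open>The one-parameter family and its telescoping certificate\<close>

definition cubic_term :: "complex \<Rightarrow> complex \<Rightarrow> nat \<Rightarrow> complex" where
  "cubic_term q b k =
     (1 - b * q ^ (3 * k + 1)) / (1 - b * q)
     * (qpoch (b * q) (q ^ 2) k * qpoch b q k * qpoch q q k
        / (qpoch (q ^ 3) (q ^ 2) k * qpoch (b * q ^ 2) (q ^ 2) k ^ 2))
     * q ^ ((k + 1) choose 2)"

text \<open>
  The usual certificate \<open>G (n + 1)\<close> is \<open>cubic_term q b (n + 1)\<close> times a rational function with
  denominator \<open>1 - b\<close>; here that factor is cancelled against \<open>(b;q)\<^sub>n\<^sub>+\<^sub>1\<close>, so that \<open>b = 1\<close> is allowed.
\<close>

definition cubic_cert :: "complex \<Rightarrow> complex \<Rightarrow> nat \<Rightarrow> complex" where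
  "cubic_cert q b n =
    b / (1 - b * q)
      * (qpoch (b * q) (q ^ 2) (Suc n) * qpoch (b * q) q n * (1 - q ^ Suc n) * qpoch q q (Suc n)
         / (qpoch (q ^ 3) (q ^ 2) n * qpoch (b * q ^ 2) (q ^ 2) (Suc n) ^ 2))
      * q ^ ((n + 2) choose 2)"

lemma power_neq_1:
  fixes q :: complex
  assumes "norm q < 1" "n > 0"
  shows "q ^ n \<noteq> 1"
  using assms power_less_one_iff [of "norm q" n] by (metis norm_ge_zero norm_one norm_power less_irrefl)

text \<open>This is the rational identity behind the induction step of
  \<open>cubic_partial_sum\<close>: with \<open>x = q ^ Suc n\<close> and the common factor
  \<open>U\<close> taken out, it reads certificate at \<open>n\<close>, plus the new summand, equals
  certificate at \<open>Suc n\<close>.\<close>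

lemma cubic_telescope:
  fixes x q b U :: complex
  assumes nz: "1 - q * x ^ 2 \<noteq> 0" "1 - b * q ^ 2 * x ^ 2 \<noteq> 0"
  shows "U * b * (1 - x)
      + (U * ((1 - b*q*x^3) * (1 - b) / (1 - q * x^2))
      - U * ((1 - b*q^3*x^3) * (1 - b*q*x^2) * (1 - b*x) * (1 - b*q*x)
             / ((1 - q*x^2) * (1 - b*q^2*x^2)^2)))
    = U * (b * (1 - b*q*x^2) * (1 - b*x) * (1 - q*x)^2 * (q*x)
             / ((1 - q*x^2) * (1 - b*q^2*x^2)^2))"
proof -
  \<comment> \<open>The numerators and the bases of the denominators stay atomic while denominators
    are cleared; a polynomial identity remains.\<close>
  have aux: "U * b * (1 - x) + (U * (N1 / Y) - U * (N2 / (Y * Z ^ 2))) = U * (N3 / (Y * Z ^ 2))"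
    if "N1 * Z ^ 2 - N2 = N3 - (1 - x) * Y * b * Z ^ 2" "Y \<noteq> 0" "Z \<noteq> 0" for N1 N2 N3 Y Z
    using that by (simp add: field_simps) algebra
  show ?thesis
    by (rule aux [OF _ nz]) algebra
qed

text \<open>Every product here is q or b times q to some positive exponents only, so one condition
  in base \<open>q\<close> excludes the zeros of all symbols in base \<open>q ^ 2\<close>.\<close>

lemma even_base_neq_1:
  fixes q b :: complex
  assumes q: "norm q < 1" and b: "\<And>i. b * q ^ Suc i \<noteq> 1"
  shows "q ^ 3 * (q ^ 2) ^ i \<noteq> 1" "b * q * (q ^ 2) ^ i \<noteq> 1" "b * q ^ 2 * (q ^ 2) ^ i \<noteq> 1"
proof -
  have "q ^ 3 * (q ^ 2) ^ i = q ^ (3 + 2 * i)" "b * q * (q ^ 2) ^ i = b * q ^ Suc (2 * i)"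
    "b * q ^ 2 * (q ^ 2) ^ i = b * q ^ Suc (2 * i + 1)"
    unfolding power_mult [symmetric]
    by (simp_all add: power_add power2_eq_square power3_eq_cube)
  then show "q ^ 3 * (q ^ 2) ^ i \<noteq> 1" "b * q * (q ^ 2) ^ i \<noteq> 1" "b * q ^ 2 * (q ^ 2) ^ i \<noteq> 1"
    using power_neq_1 [OF q, of "3 + 2 * i"] b by (metis add_pos_nonneg zero_le zero_less_numeral)+
qed

lemma qpoch_cubic_nonzero:
  assumes "norm q < 1" "\<And>i. b * q ^ Suc i \<noteq> 1"
  shows "qpoch (q ^ 3) (q ^ 2) n \<noteq> 0" "qpoch (b * q ^ 2) (q ^ 2) n \<noteq> 0"
  using even_base_neq_1 [OF assms] by (simp_all add: qpoch_eq_0_iff)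

text \<open>Consecutive certificates differ by exactly one summand, which is checked by induction.
  \<open>R\<close> is the factor that will relate S(b) to S(b q^2).\<close>

lemma cubic_partial_sum:
  assumes q: "norm q < 1" and b: "\<And>i. b * q ^ Suc i \<noteq> 1"
  defines "R \<equiv> (1 - b * q ^ 3) * (1 - b * q) / (1 - b * q ^ 2) ^ 2"
  shows "(\<Sum>k\<le>n. cubic_term q b k - R * cubic_term q (b * q ^ 2) k)
    = cubic_cert q b n"
proof (induction n)
  case 0
  have nz: "1 - b * q \<noteq> 0" "1 - b * q ^ 2 \<noteq> 0" "1 - b * q ^ 3 \<noteq> 0"
    using b[of 0] b[of 1] b[of 2] by (simp_all add: eval_nat_numeral)
  have choose_2_2: "Suc (Suc 0) choose 2 = 1"
    by (simp add: numeral_2_eq_2)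
  have "cubic_term q b 0 = 1" "cubic_term q (b * q ^ 2) 0 = 1"
    using nz by (simp_all add: cubic_term_def binomial_eq_0 mult.assoc flip: power_Suc2)
  then have "(\<Sum>k\<le>0. cubic_term q b k - R * cubic_term q (b * q ^ 2) k) = 1 - R"
    by simp
  also have "\<dots> = b * q * (1 - q) ^ 2 / (1 - b * q ^ 2) ^ 2"
    using nz unfolding R_def by (simp add: divide_simps) algebra
  also have "\<dots> = cubic_cert q b 0"
    using nz by (simp add: cubic_cert_def qpoch_Suc power2_eq_square choose_2_2)
  finally show ?case .
next
  case (Suc n)
  \<comment> \<open>Every symbol in the step is a rational function of \<open>b\<close>,
    \<open>q\<close> and \<open>x\<close> times one of the quantities below. \<open>Q\<close> starts
    at \<open>b * q\<close>, leaving out the factor \<open>1 - b\<close>, which may vanish.\<close>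
  define x where "x = q ^ Suc n"
  define P where "P = qpoch (b * q) (q ^ 2) (Suc n)"
  define Q where "Q = qpoch (b * q) q n"
  define T where "T = qpoch q q (Suc n)"
  define V where "V = qpoch (q ^ 3) (q ^ 2) n"
  define W where "W = qpoch (b * q ^ 2) (q ^ 2) (Suc n)"
  define E where "E = q ^ ((n + 2) choose 2)"
  \<comment> \<open>Chosen so that \<open>cubic_cert q b n\<close> equals
    \<open>U * b * (1 - x)\<close>.\<close>
  define U where "U = P * Q * T * E / ((1 - b * q) * V * W ^ 2)"
  have x2: "(q ^ 2) ^ Suc n = x ^ 2"
    by (simp add: x_def power_mult [symmetric] mult.commute del: power_Suc)
  have x3: "q ^ (3 * Suc n + 1) = q * x ^ 3"
    by (simp add: x_def power_mult [symmetric] mult.commute flip: power_Suc)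
  have nzb: "1 - b * q \<noteq> 0" "1 - b * q ^ 2 \<noteq> 0" "1 - b * q ^ 3 \<noteq> 0"
    using b[of 0] b[of 1] b[of 2] by (simp_all add: eval_nat_numeral)
  have "q * x ^ 2 = q ^ (2 * n + 3)" "b * q ^ 2 * x ^ 2 = b * q ^ Suc (2 * n + 3)"
    by (simp_all add: x_def power_mult [symmetric] power_add eval_nat_numeral mult_ac)
  then have nzx: "1 - q * x ^ 2 \<noteq> 0" "1 - b * q ^ 2 * x ^ 2 \<noteq> 0"
    using power_neq_1 [OF q, of "2 * n + 3"] b[of "2 * n + 3"] by (simp_all only:) simp_all
  have nz: "V \<noteq> 0" "W \<noteq> 0"
    unfolding V_def W_def using qpoch_cubic_nonzero [OF q b] by blast+
  note nz = nz nzb nzx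
  have P1: "qpoch (b * q) (q ^ 2) (Suc (Suc n)) = P * (1 - b * q * x ^ 2)"
    by (simp only: qpoch_Suc [of _ _ "Suc n"] P_def x2)
  \<comment> \<open>Replacing b by b q^2 drops the first factor of the symbol and appends one at the
    end; \<open>Q3\<close> and \<open>W2\<close> arise likewise.\<close>
  have P2: "qpoch (b * q ^ 3) (q ^ 2) (Suc n) = P * (1 - b * q * x ^ 2) / (1 - b * q)"
    using nz P1 by (simp add: qpoch_Suc_shift [of _ _ "Suc n"] field_simps eval_nat_numeral)
  have Q1: "qpoch b q (Suc n) = (1 - b) * Q"
    by (simp add: qpoch_Suc_shift Q_def)
  have Q2: "qpoch (b * q) q (Suc n) = Q * (1 - b * x)"
    by (simp add: qpoch_Suc Q_def x_def mult_ac)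
  have Q3: "qpoch (b * q ^ 2) q (Suc n) = Q * (1 - b * x) * (1 - b * q * x) / (1 - b * q)"
  proof -
    have "(1 - b * q) * qpoch (b * q ^ 2) q (Suc n) = qpoch (b * q) q (Suc (Suc n))"
      by (simp add: qpoch_Suc_shift [of _ _ "Suc n"] power2_eq_square mult.assoc)
    also have "\<dots> = Q * (1 - b * x) * (1 - b * q * x)"
      by (simp only: qpoch_Suc [of _ _ "Suc n"] Q2 x_def)
    finally show ?thesis using nz by (simp add: field_simps)
  qed
  have T1: "qpoch q q (Suc (Suc n)) = T * (1 - q * x)"
    by (simp only: qpoch_Suc [of _ _ "Suc n"] T_def x_def)
  have V1: "qpoch (q ^ 3) (q ^ 2) (Suc n) = V * (1 - q * x ^ 2)"
  proof -
    have "q ^ 3 * (q ^ 2) ^ n = q * (q ^ 2) ^ Suc n" by (simp add: eval_nat_numeral)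
    then show ?thesis by (simp only: qpoch_Suc V_def x2)
  qed
  have W1: "qpoch (b * q ^ 2) (q ^ 2) (Suc (Suc n)) = W * (1 - b * q ^ 2 * x ^ 2)"
    by (simp only: qpoch_Suc [of _ _ "Suc n"] W_def x2)
  have W2: "qpoch (b * q ^ 2 * q ^ 2) (q ^ 2) (Suc n) = W * (1 - b * q ^ 2 * x ^ 2) / (1 - b * q ^ 2)"
    using nz W1 by (simp add: qpoch_Suc_shift [of _ _ "Suc n"] field_simps)
  have E1: "q ^ ((Suc n + 2) choose 2) = E * (q * x)"
    by (simp add: E_def x_def power_add [symmetric] eval_nat_numeral ac_simps)
  have "cubic_term q b (Suc n) = U * ((1 - b*q*x^3) * (1 - b) / (1 - q * x^2))"
    unfolding cubic_term_def x3 Q1 V1 U_def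
    unfolding P_def [symmetric] T_def [symmetric] W_def [symmetric]
    by (simp add: E_def mult_ac)
  moreover have "R * cubic_term q (b * q ^ 2) (Suc n)
      = U * ((1 - b*q^3*x^3) * (1 - b*q*x^2) * (1 - b*x) * (1 - b*q*x)
             / ((1 - q*x^2) * (1 - b*q^2*x^2)^2))"
  proof -
    have *: "b * q ^ 2 * q = b * q ^ 3" "b * q ^ 2 * (q * x ^ 3) = b * q ^ 3 * x ^ 3"
      by (simp_all add: eval_nat_numeral)
    show ?thesis
      unfolding cubic_term_def x3 * P2 Q3 V1 W2 U_def R_def
      unfolding T_def [symmetric]
      using nz by (simp add: E_def power2_eq_square) (simp add: mult_ac)
  qed
  ultimately have "(\<Sum>k\<le>Suc n. cubic_term q b k - R * cubic_term q (b * q ^ 2) k)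
    = U * b * (1 - x)
      + (U * ((1 - b*q*x^3) * (1 - b) / (1 - q * x^2))
      - U * ((1 - b*q^3*x^3) * (1 - b*q*x^2) * (1 - b*x) * (1 - b*q*x)
             / ((1 - q*x^2) * (1 - b*q^2*x^2)^2)))"
    unfolding sum.atMost_Suc Suc.IH cubic_cert_def
    unfolding U_def P_def [symmetric] Q_def [symmetric] T_def [symmetric] V_def [symmetric]
      W_def [symmetric] E_def [symmetric] x_def [symmetric]
    by (simp add: mult_ac)
  also have "\<dots> = U * (b * (1 - b*q*x^2) * (1 - b*x) * (1 - q*x)^2 * (q*x)
             / ((1 - q*x^2) * (1 - b*q^2*x^2)^2))"
    by (rule cubic_telescope [OF nzx])
  also have "\<dots> = b / (1 - b * q)
      * (P * (1 - b*q*x^2) * (Q * (1 - b*x)) * (1 - q*x) * (T * (1 - q*x))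
         / (V * (1 - q*x^2) * (W * (1 - b*q^2*x^2)) ^ 2)) * (E * (q*x))"
    unfolding U_def by (simp add: power2_eq_square mult_ac)
  finally show ?case
    unfolding cubic_cert_def P1 Q2 T1 V1 W1 E1 by (simp add: x_def)
qed

section \<open>Limits: the vanishing certificate and dominated convergence in b\<close>

lemma cubic_cert_tendsto_0:
  assumes q: "norm q < 1" and b: "\<And>i. b * q ^ Suc i \<noteq> 1"
  shows "cubic_cert q b \<longlonglongrightarrow> 0"
proof -
  have q2: "norm (q ^ 2) < 1"
    using q by (simp add: norm_power power_less_one_iff)
  \<comment> \<open>The exponent is at least \<open>n\<close>, so this power of \<open>q\<close>
    tends to 0 while all symbols in the certificate converge, those in the denominator to nonzero
    limits.\<close>
  have "filterlim (\<lambda>n. (n + 2) choose 2) sequentially sequentially"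
    by (rule filterlim_at_top_mono [OF filterlim_ident]) (simp add: eval_nat_numeral)
  then have pow: "(\<lambda>n. q ^ ((n + 2) choose 2)) \<longlonglongrightarrow> 0"
    using LIMSEQ_power_zero [OF q] filterlim_compose by blast
  have nz: "qpoch_inf (q ^ 3) (q ^ 2) \<noteq> 0" "qpoch_inf (b * q ^ 2) (q ^ 2) \<noteq> 0"
    using even_base_neq_1 [OF q b] by (simp_all add: qpoch_inf_eq_0_iff [OF q2])
  have "cubic_cert q b \<longlonglongrightarrow>
    b / (1 - b * q)
      * (qpoch_inf (b * q) (q ^ 2) * qpoch_inf (b * q) q * (1 - 0) * qpoch_inf q q
         / (qpoch_inf (q ^ 3) (q ^ 2) * qpoch_inf (b * q ^ 2) (q ^ 2) ^ 2)) * 0"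
    unfolding cubic_cert_def [abs_def] using q q2 nz
    by (intro tendsto_intros pow qpoch_tendsto_qpoch_inf LIMSEQ_Suc LIMSEQ_power_zero) auto
  then show ?thesis by simp
qed

text \<open>Tannery's theorem: by the Weierstrass M-test the partial sums converge uniformly in
  \<open>m\<close>, so the two limits may be exchanged.\<close>

lemma suminf_dominated_tendsto:
  fixes f :: "nat \<Rightarrow> nat \<Rightarrow> 'a :: banach"
  assumes bound: "\<And>m k. norm (f m k) \<le> M k" and M: "summable M"
    and lim: "\<And>k. (\<lambda>m. f m k) \<longlonglongrightarrow> g k"
  shows "(\<lambda>m. suminf (f m)) \<longlonglongrightarrow> suminf g"
proof (rule swap_uniform_limit' [where S = UNIV and F = sequentially])
  show "\<forall>\<^sub>F n in sequentially. (\<lambda>m. \<Sum>k<n. f m k) \<longlonglongrightarrow> (\<Sum>k<n. g k)"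
    by (intro always_eventually allI tendsto_sum lim)
  have "norm (g k) \<le> M k" for k
    by (rule tendsto_upperbound [OF tendsto_norm [OF lim]]) (simp_all add: bound)
  then show "(\<lambda>n. \<Sum>k<n. g k) \<longlonglongrightarrow> suminf g"
    by (intro summable_LIMSEQ summable_comparison_test' [OF M])
  show "uniform_limit UNIV (\<lambda>n m. \<Sum>k<n. f m k) (\<lambda>m. suminf (f m)) sequentially"
    by (rule Weierstrass_m_test [OF bound M])
qed simp_all

text \<open>A geometric majorant independent of \<open>m\<close>, as Tannery's theorem requires:
  numerators are bounded by \<open>norm_qpoch_le\<close>, denominators by
  \<open>qpoch_shift_bounded_below\<close>, and the decay comes from the binomial power of
  \<open>q\<close>.\<close>

lemma cubic_term_bound:
  assumes q: "norm q < 1" and b: "\<And>i. b * q ^ Suc i \<noteq> 1"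
  obtains M where "\<And>m k. norm (cubic_term q (b * (q ^ 2) ^ m) k) \<le> M * norm q ^ k"
proof -
  have q2: "norm (q ^ 2) < 1"
    using q by (simp add: norm_power power_less_one_iff)
  obtain c1 where c1: "c1 > 0" "\<And>m n. c1 \<le> norm (qpoch (b * q * (q ^ 2) ^ m) (q ^ 2) n)"
    using qpoch_shift_bounded_below [OF q2 even_base_neq_1(2) [OF q b]] by blast
  obtain c2 where c2: "c2 > 0" "\<And>m n. c2 \<le> norm (qpoch (b * q ^ 2 * (q ^ 2) ^ m) (q ^ 2) n)"
    using qpoch_shift_bounded_below [OF q2 even_base_neq_1(3) [OF q b]] by blast
  obtain c3 where c3: "c3 > 0" "\<And>m n. c3 \<le> norm (qpoch (q ^ 3 * (q ^ 2) ^ m) (q ^ 2) n)"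
    using qpoch_shift_bounded_below [OF q2 even_base_neq_1(1) [OF q b]] by blast
  define E where "E = exp (norm b / (1 - norm (q ^ 2)))"
  define E1 where "E1 = exp (norm b / (1 - norm q))"
  define E2 where "E2 = exp (1 / (1 - norm q))"
  have le1: "norm q ^ i \<le> 1" for i
    using q by (simp add: power_le_one)
  show thesis
  proof (rule that)
    fix m k
    define B where "B = b * (q ^ 2) ^ m"
    have B: "norm B \<le> norm b"
      unfolding B_def by (simp add: norm_mult norm_power mult_left_le le1 flip: power_mult)
    have Bq: "norm (B * q ^ i) \<le> norm b" for i
      using mult_mono [OF B le1 [of i]] by (simp add: norm_mult norm_power)
    have 1: "norm (1 - B * q ^ (3 * k + 1)) \<le> 1 + norm b"
      using norm_triangle_ineq4 [of 1 "B * q ^ (3 * k + 1)"] Bq [of "3 * k + 1"] by simp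
    \<comment> \<open>The denominator \<open>1 - B * q\<close> of the prefactor is a symbol of
      length one, so the bound \<open>c1\<close> covers it.\<close>
    have 2: "c1 \<le> norm (1 - B * q)"
      using c1(2) [of m "Suc 0"] by (simp add: qpoch_Suc B_def mult_ac)
    have 3: "norm (qpoch (B * q) (q ^ 2) k) \<le> E"
      unfolding E_def using Bq [of 1] by (intro norm_qpoch_le q2) simp
    have 4: "norm (qpoch B q k) \<le> E1"
      unfolding E1_def by (intro norm_qpoch_le q B)
    have 5: "norm (qpoch q q k) \<le> E2"
      unfolding E2_def using q by (intro norm_qpoch_le) simp_all
    have 6: "c3 \<le> norm (qpoch (q ^ 3) (q ^ 2) k)"
      using c3(2) [of 0 k] by simp
    have 7: "c2 \<le> norm (qpoch (B * q ^ 2) (q ^ 2) k)"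
      using c2(2) [of m k] by (simp add: B_def mult_ac)
    have "k \<le> (k + 1) choose 2"
      by (simp add: eval_nat_numeral)
    then have 8: "norm q ^ ((k + 1) choose 2) \<le> norm q ^ k"
      using q by (intro power_decreasing) simp_all
    have "norm (cubic_term q B k) \<le> (1 + norm b) / c1 * (E * E1 * E2 / (c3 * c2 ^ 2)) * norm q ^ k"
      unfolding cubic_term_def norm_mult norm_divide norm_power
      by (intro mult_mono frac_le power_mono mult_pos_pos zero_less_power 1 2 3 4 5 6 7 8
            mult_nonneg_nonneg divide_nonneg_nonneg c1 c2 c3 norm_ge_zero zero_le_power)
        (use c1(1) c2(1) c3(1) in \<open>simp_all add: E_def E1_def E2_def\<close>)
    then show "norm (cubic_term q (b * (q ^ 2) ^ m) k)
        \<le> (1 + norm b) / c1 * (E * E1 * E2 / (c3 * c2 ^ 2)) * norm q ^ k"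
      by (simp add: B_def)
  qed
qed

lemma summable_cubic_term:
  assumes q: "norm q < 1" and b: "\<And>i. b * q ^ Suc i \<noteq> 1"
  shows "summable (cubic_term q b)"
proof -
  obtain M where M: "\<And>m k. norm (cubic_term q (b * (q ^ 2) ^ m) k) \<le> M * norm q ^ k"
    using cubic_term_bound [OF q b] by blast
  have "summable (\<lambda>k. M * norm q ^ k)"
    using q by (intro summable_mult summable_geometric) simp
  then show ?thesis
    by (rule summable_comparison_test' [where N = 0]) (use M [of 0] in simp)
qed

lemma tendsto_cubic_term_0:
  assumes q: "norm q < 1" and f: "(f \<longlongrightarrow> 0) F"
  shows "((\<lambda>t. cubic_term q (f t) k) \<longlongrightarrow> cubic_term q 0 k) F"
  \<comment> \<open>The fact is instantiated at \<open>b = 0\<close>, where its condition on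
    \<open>b\<close> is trivial.\<close>
  unfolding cubic_term_def using qpoch_cubic_nonzero(1) [OF q, of 0]
  by (intro tendsto_intros f) simp_all

lemma suminf_cubic_term_tendsto:
  assumes q: "norm q < 1" and b: "\<And>i. b * q ^ Suc i \<noteq> 1"
  shows "(\<lambda>m. suminf (cubic_term q (b * (q ^ 2) ^ m))) \<longlonglongrightarrow> suminf (cubic_term q 0)"
proof -
  obtain M where M: "\<And>m k. norm (cubic_term q (b * (q ^ 2) ^ m) k) \<le> M * norm q ^ k"
    using cubic_term_bound [OF q b] by blast
  show ?thesis
  proof (rule suminf_dominated_tendsto [OF M])
    show "summable (\<lambda>k. M * norm q ^ k)"
      using q by (intro summable_mult summable_geometric) simp
    fix k
    have "norm (q ^ 2) < 1"
      using q by (simp add: norm_power power_less_one_iff)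
    then have "(\<lambda>m. b * (q ^ 2) ^ m) \<longlonglongrightarrow> 0"
      by (intro tendsto_mult_right_zero LIMSEQ_power_zero)
    then show "(\<lambda>m. cubic_term q (b * (q ^ 2) ^ m) k) \<longlonglongrightarrow> cubic_term q 0 k"
      by (rule tendsto_cubic_term_0 [OF q])
  qed
qed

section \<open>The functional equation in b and its iteration\<close>

lemma suminf_cubic_term_rec:
  assumes q: "norm q < 1" and b: "\<And>i. b * q ^ Suc i \<noteq> 1"
  shows "suminf (cubic_term q b)
    = (1 - b * q ^ 3) * (1 - b * q) / (1 - b * q ^ 2) ^ 2 * suminf (cubic_term q (b * q ^ 2))"
proof -
  define R where "R = (1 - b * q ^ 3) * (1 - b * q) / (1 - b * q ^ 2) ^ 2"
  have "b * q ^ 2 * q ^ Suc i \<noteq> 1" for i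
    using b [of "i + 2"] by (simp add: power_add power2_eq_square mult_ac)
  then have "(\<lambda>k. cubic_term q b k - R * cubic_term q (b * q ^ 2) k)
      sums (suminf (cubic_term q b) - R * suminf (cubic_term q (b * q ^ 2)))"
    by (intro sums_diff sums_mult summable_sums summable_cubic_term q b)
  moreover have "(\<lambda>k. cubic_term q b k - R * cubic_term q (b * q ^ 2) k) sums 0"
    \<comment> \<open>\<open>sums_def_le\<close> has partial sums up to and including
      \<open>n\<close>, as in \<open>cubic_partial_sum\<close>.\<close>
    unfolding sums_def_le R_def cubic_partial_sum [OF q b]
    by (rule cubic_cert_tendsto_0 [OF q b])
  ultimately show ?thesis
    unfolding R_def using sums_unique2 by fastforce
qed

text \<open>Stated without division, so that each induction step cancels only the square of the one
  new factor \<open>1 - B * q ^ 2\<close>.\<close>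

lemma suminf_cubic_term_iter:
  assumes q: "norm q < 1" and b: "\<And>i. b * q ^ Suc i \<noteq> 1"
  shows "suminf (cubic_term q b) * qpoch (b * q ^ 2) (q ^ 2) n ^ 2
    = qpoch (b * q ^ 3) (q ^ 2) n * qpoch (b * q) (q ^ 2) n * suminf (cubic_term q (b * (q ^ 2) ^ n))"
proof (induction n)
  case (Suc n)
  define B where "B = b * (q ^ 2) ^ n"
  have B: "B * q ^ Suc i \<noteq> 1" for i
    using b [of "2 * n + i"] by (simp add: B_def power_add mult_ac flip: power_mult)
  have nz: "1 - B * q ^ 2 \<noteq> 0"
    using B [of 1] by (simp add: eval_nat_numeral)
  have "suminf (cubic_term q b) * qpoch (b * q ^ 2) (q ^ 2) (Suc n) ^ 2
    = (suminf (cubic_term q b) * qpoch (b * q ^ 2) (q ^ 2) n ^ 2) * (1 - B * q ^ 2) ^ 2"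
    by (simp add: qpoch_Suc B_def power_mult_distrib mult_ac)
  also have "\<dots> = qpoch (b * q ^ 3) (q ^ 2) n * qpoch (b * q) (q ^ 2) n
      * ((1 - B * q ^ 3) * (1 - B * q)) * suminf (cubic_term q (B * q ^ 2))"
    unfolding Suc.IH B_def [symmetric] suminf_cubic_term_rec [OF q B] using nz by simp
  also have "\<dots> = qpoch (b * q ^ 3) (q ^ 2) (Suc n) * qpoch (b * q) (q ^ 2) (Suc n)
      * suminf (cubic_term q (b * (q ^ 2) ^ Suc n))"
    by (simp add: qpoch_Suc B_def mult_ac)
  finally show ?case .
qed simp

text \<open>Both sides are limits of the iterated equation: b q^(2n) tends to 0, so the remaining
  sum tends to S(0), whose value is still unknown here.\<close>

lemma suminf_cubic_term_limit:
  assumes q: "norm q < 1" and b: "\<And>i. b * q ^ Suc i \<noteq> 1"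
  shows "suminf (cubic_term q b) * qpoch_inf (b * q ^ 2) (q ^ 2) ^ 2
    = qpoch_inf (b * q ^ 3) (q ^ 2) * qpoch_inf (b * q) (q ^ 2) * suminf (cubic_term q 0)"
proof (rule LIMSEQ_unique)
  have q2: "norm (q ^ 2) < 1"
    using q by (simp add: norm_power power_less_one_iff)
  show "(\<lambda>n. suminf (cubic_term q b) * qpoch (b * q ^ 2) (q ^ 2) n ^ 2)
      \<longlonglongrightarrow> suminf (cubic_term q b) * qpoch_inf (b * q ^ 2) (q ^ 2) ^ 2"
    by (intro tendsto_intros qpoch_tendsto_qpoch_inf q2)
  show "(\<lambda>n. suminf (cubic_term q b) * qpoch (b * q ^ 2) (q ^ 2) n ^ 2)
      \<longlonglongrightarrow> qpoch_inf (b * q ^ 3) (q ^ 2) * qpoch_inf (b * q) (q ^ 2) * suminf (cubic_term q 0)"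
    unfolding suminf_cubic_term_iter [OF q b]
    by (intro tendsto_intros qpoch_tendsto_qpoch_inf q2 suminf_cubic_term_tendsto [OF q b])
qed

section \<open>Closed form of S(b), and specialization to b = q\<close>

lemma cubic_term_sums:
  assumes q: "norm q < 1" and b: "\<And>i. b * q ^ Suc i \<noteq> 1"
  shows "cubic_term q b sums
    (qpoch_inf (b * q ^ 3) (q ^ 2) * qpoch_inf (b * q) (q ^ 2) * qpoch_inf (q ^ 2) (q ^ 2) ^ 2
      / (qpoch_inf (b * q ^ 2) (q ^ 2) ^ 2 * qpoch_inf q (q ^ 2) * qpoch_inf (q ^ 3) (q ^ 2)))"
proof -
  have q2: "norm (q ^ 2) < 1"
    using q by (simp add: norm_power power_less_one_iff)
  have one: "1 * q ^ Suc i \<noteq> 1" for i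
    using power_neq_1 [OF q, of "Suc i"] by simp
  \<comment> \<open>At \<open>k = 0\<close> the prefactor is \<open>(1 - q) / (1 - q)\<close>, which
    is 1 because \<open>q\<close> differs from 1.\<close>
  have "cubic_term q 1 = (\<lambda>k. if k = 0 then 1 else 0)"
    using one [of 0] by (auto simp: fun_eq_iff cubic_term_def qpoch_1_left binomial_eq_0)
  then have "suminf (cubic_term q 1) = 1"
    using suminf_finite [of "{0}" "cubic_term q 1"] by simp
  \<comment> \<open>This determines S(0), since both products on the right are nonzero.\<close>
  then have "qpoch_inf (q ^ 2) (q ^ 2) ^ 2
      = qpoch_inf (q ^ 3) (q ^ 2) * qpoch_inf q (q ^ 2) * suminf (cubic_term q 0)"
    using suminf_cubic_term_limit [OF q one] by simp
  moreover have "qpoch_inf (q ^ 3) (q ^ 2) \<noteq> 0" "qpoch_inf q (q ^ 2) \<noteq> 0"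
      "qpoch_inf (b * q ^ 2) (q ^ 2) \<noteq> 0"
    using even_base_neq_1 [OF q b] even_base_neq_1(2) [OF q one]
    by (simp_all add: qpoch_inf_eq_0_iff [OF q2])
  ultimately have "suminf (cubic_term q b)
      = qpoch_inf (b * q ^ 3) (q ^ 2) * qpoch_inf (b * q) (q ^ 2) * qpoch_inf (q ^ 2) (q ^ 2) ^ 2
      / (qpoch_inf (b * q ^ 2) (q ^ 2) ^ 2 * qpoch_inf q (q ^ 2) * qpoch_inf (q ^ 3) (q ^ 2))"
    using suminf_cubic_term_limit [OF q b] by (simp add: field_simps)
  then show ?thesis
    using summable_sums [OF summable_cubic_term [OF q b]] by simp
qed

theorem theorem2p5:
  fixes q :: complex
  assumes "norm q < 1"
  shows "(\<lambda>k. (1 - q ^ (3 * k + 2)) / (1 - q ^ 2)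
              * (qpoch (q ^ 2) (q ^ 2) k * (qpoch q q k) ^ 2 / (qpoch (q ^ 3) (q ^ 2) k) ^ 3)
              * q ^ ((k + 1) choose 2))
         sums
         (qpoch_inf (q ^ 4) (q ^ 2) * (qpoch_inf (q ^ 2) (q ^ 2)) ^ 3
            / (qpoch_inf q (q ^ 2) * (qpoch_inf (q ^ 3) (q ^ 2)) ^ 3))"
proof -
  have "q * q ^ Suc i \<noteq> 1" for i
    using power_neq_1 [OF assms, of "Suc (Suc i)"] by simp
  note sums = cubic_term_sums [OF assms this]
  have powers: "q * q = q ^ 2" "q * q ^ 2 = q ^ 3" "q * q ^ 3 = q ^ 4" "q * q ^ (3 * k + 1) = q ^ (3 * k + 2)" for k
    by (simp_all add: eval_nat_numeral)
  \<comment> \<open>At \<open>b = q\<close> several symbols coincide. These equations merge them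
    into squares and cubes, matching the order of factors in the general formula.\<close>
  have cube: "x * y * y = x * y ^ 2" "x * y * y ^ 2 = x * y ^ 3" "x * x ^ 2 = x ^ 3" "x ^ 2 * y * x = y * x ^ 3"
    for x y :: complex
    by (simp_all add: power2_eq_square power3_eq_cube)
  show ?thesis
    using sums unfolding cubic_term_def [abs_def] powers cube .
qed

end
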